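(* Let $(\bar c,\bar b)\in\mathbb{R}^p\times C(T,\mathbb{R})$, assume that $P(\bar c,\bar b)$ satisfies the Slater condition, and let $\bar x\in\mathcal{S}(\bar c,\bar b)$. Then $$\mathrm{clm}\,\mathcal{S}\big((\bar c,\bar b),\bar x\big)\ \le\ \max\{\bar\lambda,1\}\ \mathrm{clm}\,\mathcal{L}\big((\langle\bar c,\bar x\rangle,\bar b),\bar x\big),$$ where $$\bar\lambda:=\inf_{(\alpha,z)\in\mathcal{G}_{\bar b}(\bar x)}\frac{-\langle\bar c,z\rangle}{\alpha}.$$
   Context: Setting: $T$ is a compact Hausdorff space, $t\mapsto a_t\in\mathbb{R}^p$ is a fixed continuous function on $T$, and $C(T,\mathbb{R})$ is the space of continuous functions $b=(b_t)_{t\in T}$ with $\|b\|_\infty=\max_{t\in T}|b_t|$. $\mathbb{R}^p$ carries an arbitrary norm $\|\cdot\|$ with dual norm $\|u\|_*=\max_{\|x\|\le1}\langle u,x\rangle$. For $(c,b)\in\mathbb{R}^p\times C(T,\mathbb{R})$, $P(c,b)$ is the problem: minimize $\langle c,x\rangle$ subject to $\langle a_t,x\rangle\le b_t$ for all $t\in T$. The parameter space $\mathbb{R}^p\times C(T,\mathbb{R})$ has norm $\|(c,b)\|=\max\{\|c\|_*,\|b\|_\infty\}$. $\mathcal{S}(c,b)\subset\mathbb{R}^p$ is the set of optimal solutions of $P(c,b)$. The Slater condition holds for $P(c,b)$ if there is $\hat x\in\mathbb{R}^p$ with $\langle a_t,\hat x\rangle<b_t$ for all $t\in T$. Level set mapping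 (for the fixed $\bar c$): $\mathcal{L}:\mathbb{R}\times C(T,\mathbb{R})\rightrightarrows\mathbb{R}^p$, $$\mathcal{L}(\alpha,b)=\{x\in\mathbb{R}^p:\langle\bar c,x\rangle\le\alpha;\ \langle a_t,x\rangle\le b_t,\ t\in T\},$$ where $\mathbb{R}\times C(T,\mathbb{R})$ has the norm $\|(\alpha,b)\|=\max\{|\alpha|,\|b\|_\infty\}$. Calmness modulus: for a set-valued mapping $S$ from a metric space $(Y,d_Y)$ to a metric space $(X,d_X)$ and $\bar x\in S(\bar y)$, $\mathrm{clm}\,S(\bar y,\bar x)\in[0,\infty]$ is the infimum of all $\kappa\ge0$ for which there are neighborhoods $U$ of $\bar x$ and $V$ of $\bar y$ with $d_X(x,S(\bar y))\le\kappa\, d_Y(y,\bar y)$ whenever $y\in V$ and $x\in S(y)\cap U$ (it is $+\infty$ if no such $\kappa$ exists). Active indices: $T_b(x)=\{t\in T:\langle a_t,x\rangle=b_t\}$ for feasible $x$. With $\mathbb{S}$ the unit sphere of $(\mathbb{R}^p,\|\cdot\|)$, $$\mathcal{G}_{\bar b}(\bar x)=\{(\alpha,z)\in\mathbb{R}\times\mathbb{S}:\ \alpha>0,\ \langle a_t,z\rangle>\alpha\ \text{for all } t\in T_{\bar b}(\bar x)\}.$$ *)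

theory Defs
  imports "HOL-Analysis.Analysis"
begin

definition is_norm :: "('a::real_vector \<Rightarrow> real) \<Rightarrow> bool" where
  "is_norm N \<longleftrightarrow>
     (\<forall>x. N x = 0 \<longleftrightarrow> x = 0) \<and>
     (\<forall>r x. N (r *\<^sub>R x) = \<bar>r\<bar> * N x) \<and>
     (\<forall>x y. N (x + y) \<le> N x + N y)"

definition norm_dist :: "('a::ab_group_add \<Rightarrow> real) \<Rightarrow> 'a \<Rightarrow> 'a \<Rightarrow> real" where
  "norm_dist N x y = N (x - y)"

(* For a norm N the unit ball is compact, so the supremum is a maximum. *)
definition dual_norm :: "('a::real_inner \<Rightarrow> real) \<Rightarrow> 'a \<Rightarrow> real" where
  "dual_norm N u = (SUP x\<in>{x. N x \<le> 1}. u \<bullet> x)"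

(* Distance functions are explicit arguments because the spaces involved carry norms other
   than the one of the type class instance. Only nonempty A matters below: the base point
   of the calmness modulus lies in S y0. *)
definition dist_to_set :: "('a \<Rightarrow> 'a \<Rightarrow> real) \<Rightarrow> 'a \<Rightarrow> 'a set \<Rightarrow> real" where
  "dist_to_set d x A = (INF z\<in>A. d x z)"

(* The infimum is taken in the extended reals, so that it is \<infinity> if no constant exists. *)
definition calmness_modulus ::
  "('y \<Rightarrow> 'y \<Rightarrow> real) \<Rightarrow> ('x \<Rightarrow> 'x \<Rightarrow> real) \<Rightarrow> ('y \<Rightarrow> 'x set) \<Rightarrow> 'y \<Rightarrow> 'x \<Rightarrow> ereal" where
  "calmness_modulus dY dX S y0 x0 =
     Inf {ereal \<kappa> |\<kappa>. 0 \<le> \<kappa> \<and>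
       (\<exists>U V. openin (Metric_space.mtopology UNIV dX) U \<and> x0 \<in> U \<and>
              openin (Metric_space.mtopology UNIV dY) V \<and> y0 \<in> V \<and>
              (\<forall>y\<in>V. \<forall>x\<in>S y \<inter> U. dist_to_set dX x (S y0) \<le> \<kappa> * dY y y0))}"

(* If 't is a compact space, every continuous real function on 't is bounded, hence
   't \<Rightarrow>\<^sub>C real is the space of all continuous functions with the supremum norm. *)

definition feasible_set ::
  "('t::topological_space \<Rightarrow> real ^ 'p) \<Rightarrow> ('t \<Rightarrow>\<^sub>C real) \<Rightarrow> (real ^ 'p) set" where
  "feasible_set a b = {x. \<forall>t. a t \<bullet> x \<le> apply_bcontfun b t}"

definition slater ::
  "('t::topological_space \<Rightarrow> real ^ 'p) \<Rightarrow> ('t \<Rightarrow>\<^sub>C real) \<Rightarrow> bool" where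
  "slater a b \<longleftrightarrow> (\<exists>x. \<forall>t. a t \<bullet> x < apply_bcontfun b t)"

fun optimal_set ::
  "('t::topological_space \<Rightarrow> real ^ 'p) \<Rightarrow> (real ^ 'p) \<times> ('t \<Rightarrow>\<^sub>C real) \<Rightarrow> (real ^ 'p) set" where
  "optimal_set a (c, b) =
     {x \<in> feasible_set a b. \<forall>y\<in>feasible_set a b. c \<bullet> x \<le> c \<bullet> y}"

fun level_set ::
  "('t::topological_space \<Rightarrow> real ^ 'p) \<Rightarrow> real ^ 'p \<Rightarrow> real \<times> ('t \<Rightarrow>\<^sub>C real) \<Rightarrow> (real ^ 'p) set" where
  "level_set a c (\<alpha>, b) = {x. c \<bullet> x \<le> \<alpha> \<and> (\<forall>t. a t \<bullet> x \<le> apply_bcontfun b t)}"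

(* The parameter spaces carry maximum norms, unlike the library norm on products. *)

fun param_norm ::
  "(real ^ 'p \<Rightarrow> real) \<Rightarrow> (real ^ 'p) \<times> ('t::topological_space \<Rightarrow>\<^sub>C real) \<Rightarrow> real" where
  "param_norm N (c, b) = max (dual_norm N c) (norm b)"

fun level_param_norm :: "real \<times> ('t::topological_space \<Rightarrow>\<^sub>C real) \<Rightarrow> real" where
  "level_param_norm (\<alpha>, b) = max \<bar>\<alpha>\<bar> (norm b)"

definition clm_optimal ::
  "(real ^ 'p \<Rightarrow> real) \<Rightarrow> ('t::topological_space \<Rightarrow> real ^ 'p) \<Rightarrow>
   (real ^ 'p) \<times> ('t \<Rightarrow>\<^sub>C real) \<Rightarrow> real ^ 'p \<Rightarrow> ereal" where
  "clm_optimal N a =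
     calmness_modulus (norm_dist (param_norm N)) (norm_dist N) (optimal_set a)"

definition clm_level ::
  "(real ^ 'p \<Rightarrow> real) \<Rightarrow> ('t::topological_space \<Rightarrow> real ^ 'p) \<Rightarrow> real ^ 'p \<Rightarrow>
   real \<times> ('t \<Rightarrow>\<^sub>C real) \<Rightarrow> real ^ 'p \<Rightarrow> ereal" where
  "clm_level N a c =
     calmness_modulus (norm_dist level_param_norm) (norm_dist N) (level_set a c)"

definition active_indices ::
  "('t::topological_space \<Rightarrow> real ^ 'p) \<Rightarrow> ('t \<Rightarrow>\<^sub>C real) \<Rightarrow> real ^ 'p \<Rightarrow> 't set" where
  "active_indices a b x = {t. a t \<bullet> x = apply_bcontfun b t}"

definition G_set ::
  "(real ^ 'p \<Rightarrow> real) \<Rightarrow> ('t::topological_space \<Rightarrow> real ^ 'p) \<Rightarrow> ('t \<Rightarrow>\<^sub>C real) \<Rightarrow>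
   real ^ 'p \<Rightarrow> (real \<times> (real ^ 'p)) set" where
  "G_set N a b x =
     {(\<alpha>, z). N z = 1 \<and> \<alpha> > 0 \<and> (\<forall>t\<in>active_indices a b x. a t \<bullet> z > \<alpha>)}"

definition lambda_bar ::
  "(real ^ 'p \<Rightarrow> real) \<Rightarrow> ('t::topological_space \<Rightarrow> real ^ 'p) \<Rightarrow> real ^ 'p \<Rightarrow>
   ('t \<Rightarrow>\<^sub>C real) \<Rightarrow> real ^ 'p \<Rightarrow> ereal" where
  "lambda_bar N a c b x = (INF (\<alpha>, z)\<in>G_set N a b x. ereal (- (c \<bullet> z) / \<alpha>))"

end

theory Submission
  imports Defs
begin

text \<open>
  The optimal set \<open>S(c,b)\<close> is the level set of \<open>b\<close> at the level \<open>\<langle>c,x\<rangle>\<close>. If \<open>(\<alpha>,z)\<close> lies in the set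
  \<open>G\<close> and \<open>(c',b')\<close> has distance \<open>\<delta>\<close> from \<open>(c,b)\<close>, then for small \<open>\<delta>\<close> the point \<open>x - (\<delta>/\<alpha>) z\<close> is
  feasible for \<open>b'\<close>, by compactness of the index space. Comparing it with a solution \<open>x'\<close> of
  \<open>P(c',b')\<close> near \<open>x\<close> shows that \<open>\<langle>c,x'\<rangle>\<close> exceeds \<open>\<langle>c,x\<rangle>\<close> by at most \<open>\<delta> (-\<langle>c,z\<rangle>/\<alpha> + o(1))\<close>.
  Hence \<open>x'\<close> lies in a level set whose parameters are perturbed by at most
  \<open>max 1 (-\<langle>c,z\<rangle>/\<alpha> + o(1)) \<delta>\<close>, and calmness of the level set mapping applies.
\<close>

subsection \<open>Norms and their metrics\<close>

lemma is_norm_zero: "is_norm N \<Longrightarrow> N x = 0 \<longleftrightarrow> x = 0"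
  and is_norm_scale: "is_norm N \<Longrightarrow> N (r *\<^sub>R x) = \<bar>r\<bar> * N x"
  and is_norm_triangle: "is_norm N \<Longrightarrow> N (x + y) \<le> N x + N y"
  by (simp_all add: is_norm_def)

lemma is_norm_minus: "is_norm N \<Longrightarrow> N (- x) = N x"
  using is_norm_scale[of N "-1" x] by simp

lemma is_norm_nonneg: "is_norm N \<Longrightarrow> 0 \<le> N x"
  using is_norm_triangle[of N x "- x"] is_norm_zero[of N 0] is_norm_minus[of N x] by simp

lemma Metric_space_norm_dist:
  assumes "is_norm N"
  shows "Metric_space UNIV (norm_dist N)"
proof
  fix x y z
  show "0 \<le> norm_dist N x y"
    by (simp add: norm_dist_def is_norm_nonneg[OF assms])
  show "norm_dist N x y = norm_dist N y x"
    using is_norm_minus[OF assms, of "x - y"] by (simp add: norm_dist_def)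
  show "norm_dist N x y = 0 \<longleftrightarrow> x = y"
    by (simp add: norm_dist_def is_norm_zero[OF assms])
  show "norm_dist N x z \<le> norm_dist N x y + norm_dist N y z"
    using is_norm_triangle[OF assms, of "x - y" "y - z"] by (simp add: norm_dist_def)
qed

section \<open>Comparison with the Euclidean norm\<close>

lemma is_norm_sum:
  assumes "is_norm N" "finite A"
  shows "N (sum f A) \<le> (\<Sum>i\<in>A. N (f i))"
  using assms(2)
proof (induction A rule: finite_induct)
  case empty
  then show ?case using is_norm_zero[OF assms(1), of 0] by simp
next
  case (insert i A)
  then show ?case using is_norm_triangle[OF assms(1), of "f i" "sum f A"] by simp
qed

lemma is_norm_le_norm:
  fixes N :: "'a::euclidean_space \<Rightarrow> real"
  assumes "is_norm N"
  obtains K where "0 < K" "\<And>x. N x \<le> K * norm x"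
proof
  \<comment> \<open>The sum already bounds N by the triangle inequality in coordinates; adding 1
    makes the constant positive.\<close>
  let ?K = "(\<Sum>i\<in>Basis. N i) + 1"
  show "0 < ?K"
    using sum_nonneg[of "Basis :: 'a set" N] is_norm_nonneg[OF assms] by force
  show "N x \<le> ?K * norm x" for x
  proof -
    have "N x = N (\<Sum>i\<in>Basis. (x \<bullet> i) *\<^sub>R i)"
      by (simp add: euclidean_representation)
    also have "\<dots> \<le> (\<Sum>i\<in>Basis. N ((x \<bullet> i) *\<^sub>R i))"
      by (rule is_norm_sum[OF assms]) simp
    also have "\<dots> \<le> (\<Sum>i\<in>Basis. norm x * N i)"
      by (intro sum_mono)
        (simp add: is_norm_scale[OF assms] Basis_le_norm is_norm_nonneg[OF assms] mult_right_mono)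
    also have "\<dots> \<le> ?K * norm x"
      by (simp add: sum_distrib_left distrib_left mult.commute)
    finally show ?thesis .
  qed
qed

text \<open>The reverse triangle inequality and the bound by the Euclidean norm make N
  Lipschitz.\<close>

lemma is_norm_continuous_on:
  fixes N :: "'a::euclidean_space \<Rightarrow> real"
  assumes "is_norm N"
  shows "continuous_on S N"
proof -
  obtain K where K: "0 < K" "\<And>x. N x \<le> K * norm x"
    using is_norm_le_norm[OF assms] by blast
  have "\<bar>N x - N y\<bar> \<le> K * dist x y" for x y
  proof -
    have "N x \<le> N (x - y) + N y" "N y \<le> N (y - x) + N x"
      using is_norm_triangle[OF assms, of "x - y" y] is_norm_triangle[OF assms, of "y - x" x]
      by simp_all
    moreover have "N (y - x) = N (x - y)"
      using is_norm_minus[OF assms, of "x - y"] by simp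
    ultimately show ?thesis
      using K(2)[of "x - y"] by (simp add: dist_norm)
  qed
  then have "K-lipschitz_on S N"
    using K(1) by (intro lipschitz_onI) (auto simp: dist_real_def)
  then show ?thesis
    by (rule lipschitz_on_continuous_on)
qed

text \<open>By continuity N attains its minimum on the compact Euclidean unit sphere. The minimum is
  positive by definiteness, and homogeneity carries it to all vectors.\<close>

lemma is_norm_ge_norm:
  fixes N :: "'a::euclidean_space \<Rightarrow> real"
  assumes "is_norm N"
  obtains k where "0 < k" "\<And>x. k * norm x \<le> N x"
proof -
  have "sphere (0::'a) 1 \<noteq> {}"
    using nonempty_Basis norm_Basis by fastforce
  then obtain u :: 'a where u: "norm u = 1" "\<And>x. norm x = 1 \<Longrightarrow> N u \<le> N x"
    using continuous_attains_inf[of "sphere (0::'a) 1" N] is_norm_continuous_on[OF assms] by auto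
  show thesis
  proof
    have "u \<noteq> 0" using u(1) by auto
    then show "0 < N u"
      using is_norm_nonneg[OF assms, of u] is_norm_zero[OF assms, of u] by simp
    show "N u * norm x \<le> N x" for x
    proof (cases "x = 0")
      case False
      then have "N u \<le> N ((1 / norm x) *\<^sub>R x)"
        by (intro u(2)) simp
      then show ?thesis
        using False by (simp add: is_norm_scale[OF assms] field_simps)
    qed (simp add: is_norm_nonneg[OF assms])
  qed
qed

section \<open>The dual norm\<close>

lemma bdd_above_dual_norm:
  fixes N :: "'a::euclidean_space \<Rightarrow> real"
  assumes "is_norm N"
  shows "bdd_above ((\<bullet>) u ` {x. N x \<le> 1})"
proof -
  obtain k where k: "0 < k" "\<And>x. k * norm x \<le> N x"
    using is_norm_ge_norm[OF assms] by blast
  have "u \<bullet> x \<le> norm u * (1 / k)" if "N x \<le> 1" for x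
  proof -
    have "k * norm x \<le> 1" using k(2)[of x] that by simp
    then have "norm x \<le> 1 / k" using k(1) by (simp add: field_simps)
    then show ?thesis
      using norm_cauchy_schwarz[of u x] mult_left_mono[of "norm x" "1 / k" "norm u"] by simp
  qed
  then show ?thesis by (auto intro!: bdd_aboveI)
qed

lemma inner_le_dual_norm:
  fixes N :: "'a::euclidean_space \<Rightarrow> real"
  assumes "is_norm N"
  shows "u \<bullet> x \<le> dual_norm N u * N x"
proof (cases "x = 0")
  case True
  then show ?thesis using is_norm_zero[OF assms, of 0] by simp
next
  case False
  then have pos: "0 < N x"
    using is_norm_nonneg[OF assms, of x] is_norm_zero[OF assms, of x] by simp
  then have "u \<bullet> ((1 / N x) *\<^sub>R x) \<le> dual_norm N u"
    unfolding dual_norm_def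
    by (intro cSUP_upper bdd_above_dual_norm[OF assms]) (simp add: is_norm_scale[OF assms])
  then show ?thesis using pos by (simp add: field_simps)
qed

lemma dual_norm_le:
  fixes N :: "'a::euclidean_space \<Rightarrow> real"
  assumes "is_norm N" "\<And>x. N x \<le> 1 \<Longrightarrow> u \<bullet> x \<le> r"
  shows "dual_norm N u \<le> r"
proof -
  have "N 0 \<le> 1" using is_norm_zero[OF assms(1), of 0] by simp
  then show ?thesis
    unfolding dual_norm_def using assms(2) by (intro cSUP_least) auto
qed

lemma dual_norm_nonneg:
  fixes N :: "'a::euclidean_space \<Rightarrow> real"
  assumes "is_norm N"
  shows "0 \<le> dual_norm N u"
proof -
  have "u \<bullet> 0 \<le> dual_norm N u"
    unfolding dual_norm_def using is_norm_zero[OF assms, of 0]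
    by (intro cSUP_upper bdd_above_dual_norm[OF assms]) simp
  then show ?thesis by simp
qed

text \<open>One inequality suffices: for r different from 0, applying it to the factor 1/r and the
  vector r u gives the reverse one.\<close>

lemma dual_norm_scale_le:
  fixes N :: "'a::euclidean_space \<Rightarrow> real"
  assumes "is_norm N"
  shows "dual_norm N (r *\<^sub>R u) \<le> \<bar>r\<bar> * dual_norm N u"
proof (rule dual_norm_le[OF assms])
  fix x assume x: "N x \<le> 1"
  have "(r *\<^sub>R u) \<bullet> x = u \<bullet> (r *\<^sub>R x)" by simp
  also have "\<dots> \<le> dual_norm N u * (\<bar>r\<bar> * N x)"
    using inner_le_dual_norm[OF assms, of u "r *\<^sub>R x"] by (simp add: is_norm_scale[OF assms])
  also have "\<dots> \<le> dual_norm N u * (\<bar>r\<bar> * 1)"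
    using x dual_norm_nonneg[OF assms] by (intro mult_left_mono) auto
  finally show "(r *\<^sub>R u) \<bullet> x \<le> \<bar>r\<bar> * dual_norm N u" by (simp add: mult.commute)
qed

lemma is_norm_dual_norm:
  fixes N :: "'a::euclidean_space \<Rightarrow> real"
  assumes "is_norm N"
  shows "is_norm (dual_norm N)"
  unfolding is_norm_def
proof (intro conjI allI)
  fix u v :: 'a and r :: real
  show "dual_norm N u = 0 \<longleftrightarrow> u = 0"
  proof
    assume "dual_norm N u = 0"
    then show "u = 0" using inner_le_dual_norm[OF assms, of u u]
      by (metis inner_gt_zero_iff mult_zero_left not_less)
  next
    assume "u = 0"
    then show "dual_norm N u = 0"
      using dual_norm_scale_le[OF assms, of 0 u] dual_norm_nonneg[OF assms, of u] by simp
  qed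
  show "dual_norm N (r *\<^sub>R u) = \<bar>r\<bar> * dual_norm N u"
  proof (cases "r = 0")
    case True
    then show ?thesis
      using dual_norm_scale_le[OF assms, of r u] dual_norm_nonneg[OF assms, of "r *\<^sub>R u"] by simp
  next
    case False
    have "\<bar>r\<bar> * dual_norm N u \<le> \<bar>r\<bar> * (\<bar>1 / r\<bar> * dual_norm N (r *\<^sub>R u))"
      using dual_norm_scale_le[OF assms, of "1 / r" "r *\<^sub>R u"] False
      by (intro mult_left_mono) auto
    then show ?thesis
      using dual_norm_scale_le[OF assms, of r u] False by (simp add: abs_divide)
  qed
  show "dual_norm N (u + v) \<le> dual_norm N u + dual_norm N v"
  proof (rule dual_norm_le[OF assms])
    fix x assume x: "N x \<le> 1"
    have "w \<bullet> x \<le> dual_norm N w" for w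
      using inner_le_dual_norm[OF assms, of w x] dual_norm_nonneg[OF assms, of w]
        mult_left_mono[OF x dual_norm_nonneg[OF assms, of w]] by simp
    from this[of u] this[of v] show "(u + v) \<bullet> x \<le> dual_norm N u + dual_norm N v"
      by (simp add: inner_add_left)
  qed
qed

section \<open>Maximum norms on the parameter spaces\<close>

lemma is_norm_max_prod:
  assumes "is_norm M" "is_norm N"
  shows "is_norm (\<lambda>(x, y). max (M x) (N y))"
  unfolding is_norm_def
proof (intro conjI allI; clarify?)
  fix x y
  have "0 \<le> M x" "0 \<le> N y"
    using assms by (simp_all add: is_norm_nonneg)
  then show "max (M x) (N y) = 0 \<longleftrightarrow> (x, y) = 0"
    using is_norm_zero[OF assms(1), of x] is_norm_zero[OF assms(2), of y]
    by (auto simp: max_def zero_prod_def)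
next
  fix r x y
  show "(case r *\<^sub>R (x, y) of (x, y) \<Rightarrow> max (M x) (N y)) = \<bar>r\<bar> * max (M x) (N y)"
    by (simp add: is_norm_scale[OF assms(1)] is_norm_scale[OF assms(2)] max_mult_distrib_left)
next
  fix x y x' y'
  show "(case (x, y) + (x', y') of (x, y) \<Rightarrow> max (M x) (N y))
      \<le> max (M x) (N y) + max (M x') (N y')"
    using is_norm_triangle[OF assms(1), of x x'] is_norm_triangle[OF assms(2), of y y'] by auto
qed

lemma is_norm_norm: "is_norm norm"
  by (simp add: is_norm_def norm_triangle_ineq)

lemma is_norm_param_norm:
  assumes "is_norm N"
  shows "is_norm (param_norm N ::
    (real ^ 'p) \<times> ('t::topological_space \<Rightarrow>\<^sub>C real) \<Rightarrow> real)" (is "is_norm ?P")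
proof -
  have "?P = (\<lambda>(c, b). max (dual_norm N c) (norm b))"
    by auto
  then show ?thesis
    using is_norm_max_prod[OF is_norm_dual_norm[OF assms] is_norm_norm] by simp
qed

lemma is_norm_level_param_norm:
  "is_norm (level_param_norm :: real \<times> ('t::topological_space \<Rightarrow>\<^sub>C real) \<Rightarrow> real)"
  (is "is_norm ?P")
proof -
  have "?P = (\<lambda>(\<alpha>, b). max (norm \<alpha>) (norm b))"
    by auto
  then show ?thesis
    using is_norm_max_prod[OF is_norm_norm is_norm_norm] by metis
qed

subsection \<open>Calmness constants\<close>

text \<open>An admissible constant in the calmness modulus, with both neighborhoods replaced by
  balls of one common radius.\<close>

definition calm_const ::
  "('y::real_vector \<Rightarrow> real) \<Rightarrow> ('x::real_vector \<Rightarrow> real) \<Rightarrow> ('y \<Rightarrow> 'x set) \<Rightarrow> 'y \<Rightarrow> 'x \<Rightarrow> real \<Rightarrow> bool"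
where
  "calm_const M N S y0 x0 \<kappa> \<longleftrightarrow> 0 \<le> \<kappa> \<and>
     (\<exists>\<epsilon>>0. \<forall>y x. M (y - y0) < \<epsilon> \<longrightarrow> N (x - x0) < \<epsilon> \<longrightarrow> x \<in> S y \<longrightarrow>
        dist_to_set (norm_dist N) x (S y0) \<le> \<kappa> * M (y - y0))"

lemma norm_dist_openin_ball:
  assumes "is_norm N" "openin (Metric_space.mtopology UNIV (norm_dist N)) U" "x0 \<in> U"
  obtains r where "r > 0" "\<And>x. N (x - x0) < r \<Longrightarrow> x \<in> U"
proof -
  interpret Metric_space UNIV "norm_dist N"
    by (rule Metric_space_norm_dist[OF assms(1)])
  obtain r where "r > 0" "mball x0 r \<subseteq> U"
    using assms(2,3) unfolding openin_mtopology by blast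
  moreover have "x \<in> mball x0 r" if "N (x - x0) < r" for x
    using that commute[of x x0] by (simp add: norm_dist_def)
  ultimately show thesis
    using that by blast
qed

lemma norm_dist_ball_openin:
  assumes "is_norm N"
  shows "openin (Metric_space.mtopology UNIV (norm_dist N)) {x. N (x - x0) < r}"
proof -
  interpret Metric_space UNIV "norm_dist N"
    by (rule Metric_space_norm_dist[OF assms])
  have "{x. N (x - x0) < r} = mball x0 r"
    using commute[of _ x0] by (auto simp: norm_dist_def)
  then show ?thesis by simp
qed

text \<open>Neighborhoods contain balls, whose smaller radius serves for both; conversely, balls are
  open neighborhoods of their centers.\<close>

lemma calmness_modulus_eq_Inf_calm_const:
  assumes M: "is_norm M" and N: "is_norm N"
  shows "calmness_modulus (norm_dist M) (norm_dist N) S y0 x0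
    = Inf {ereal \<kappa> |\<kappa>. calm_const M N S y0 x0 \<kappa>}"
proof -
  have "(\<exists>U V. openin (Metric_space.mtopology UNIV (norm_dist N)) U \<and> x0 \<in> U \<and>
              openin (Metric_space.mtopology UNIV (norm_dist M)) V \<and> y0 \<in> V \<and>
              (\<forall>y\<in>V. \<forall>x\<in>S y \<inter> U. dist_to_set (norm_dist N) x (S y0) \<le> \<kappa> * norm_dist M y y0))
     \<longleftrightarrow> (\<exists>\<epsilon>>0. \<forall>y x. M (y - y0) < \<epsilon> \<longrightarrow> N (x - x0) < \<epsilon> \<longrightarrow> x \<in> S y \<longrightarrow>
        dist_to_set (norm_dist N) x (S y0) \<le> \<kappa> * M (y - y0))" (is "?L \<longleftrightarrow> ?R") for \<kappa>
  proof
    assume ?L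
    then obtain U V where U: "openin (Metric_space.mtopology UNIV (norm_dist N)) U" "x0 \<in> U"
      and V: "openin (Metric_space.mtopology UNIV (norm_dist M)) V" "y0 \<in> V"
      and le: "\<And>y x. y \<in> V \<Longrightarrow> x \<in> S y \<Longrightarrow> x \<in> U \<Longrightarrow>
        dist_to_set (norm_dist N) x (S y0) \<le> \<kappa> * M (y - y0)"
      unfolding norm_dist_def by blast
    obtain r where r: "r > 0" "\<And>x. N (x - x0) < r \<Longrightarrow> x \<in> U"
      using norm_dist_openin_ball[OF N U] by blast
    obtain s where s: "s > 0" "\<And>y. M (y - y0) < s \<Longrightarrow> y \<in> V"
      using norm_dist_openin_ball[OF M V] by blast
    show ?R
      using r s le by (intro exI[of _ "min r s"]) simp
  next
    assume ?R
    then obtain \<epsilon> where \<epsilon>: "\<epsilon> > 0" "\<And>y x. M (y - y0) < \<epsilon> \<Longrightarrow> N (x - x0) < \<epsilon> \<Longrightarrow> x \<in> S y \<Longrightarrow>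
        dist_to_set (norm_dist N) x (S y0) \<le> \<kappa> * M (y - y0)"
      by blast
    have "M 0 = 0" "N 0 = 0" using M N by (simp_all add: is_norm_zero)
    then show ?L
      using \<epsilon> norm_dist_ball_openin[OF N, of x0 \<epsilon>] norm_dist_ball_openin[OF M, of y0 \<epsilon>]
      by (intro exI[of _ "{x. N (x - x0) < \<epsilon>}"] exI[of _ "{y. M (y - y0) < \<epsilon>}"])
        (auto simp: norm_dist_def)
  qed
  then show ?thesis
    unfolding calmness_modulus_def calm_const_def by simp
qed

subsection \<open>Perturbed linear programs\<close>

lemma continuous_on_compact_space_pos_bound:
  fixes f :: "'t::topological_space \<Rightarrow> real"
  assumes "compact K" "continuous_on K f" "\<And>t. t \<in> K \<Longrightarrow> 0 < f t"
  obtains \<mu> where "\<mu> > 0" "\<And>t. t \<in> K \<Longrightarrow> \<mu> \<le> f t"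
proof (cases "K = {}")
  case True
  then show thesis using that[of 1] by simp
next
  case False
  then obtain t where "t \<in> K" "\<And>s. s \<in> K \<Longrightarrow> f t \<le> f s"
    using continuous_attains_inf[OF assms(1) _ assms(2)] by auto
  then show thesis using that assms(3) by blast
qed

text \<open>The direction from a Slater point y to x serves as z: on an active index its product
  with \<open>a t\<close> equals the slack at y, which compactness bounds away from 0. Nonemptiness
  later keeps \<open>lambda_bar\<close> below \<infinity>.\<close>

lemma G_set_nonempty:
  fixes a :: "'t::topological_space \<Rightarrow> real ^ 'p"
  assumes T: "compact (UNIV :: 't set)" and a: "continuous_on UNIV a"
    and N: "is_norm N" and "slater a b"
  shows "G_set N a b x \<noteq> {}"
proof -
  have normalize: "N ((1 / N w) *\<^sub>R w) = 1 \<and> 0 < N w" if "w \<noteq> 0" for w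
    using that is_norm_nonneg[OF N, of w] is_norm_zero[OF N, of w]
    by (simp add: is_norm_scale[OF N])
  obtain y where y: "\<And>t. a t \<bullet> y < apply_bcontfun b t"
    using \<open>slater a b\<close> unfolding slater_def by blast
  show ?thesis
  proof (cases "x = y")
    \<comment> \<open>If x is itself a Slater point, no index is active, so any unit vector and any
      positive \<alpha> qualify.\<close>
    case True
    obtain w :: "real ^ 'p" where "w \<noteq> 0"
      using nonzero_Basis nonempty_Basis by blast
    moreover have "active_indices a b x = {}"
      using y True by (auto simp: active_indices_def less_le)
    ultimately have "(1, (1 / N w) *\<^sub>R w) \<in> G_set N a b x"
      using normalize by (simp add: G_set_def)
    then show ?thesis by blast
  next
    case False
    define w where "w = x - y"
    have w: "N ((1 / N w) *\<^sub>R w) = 1" "0 < N w"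
      using normalize[of w] False by (simp_all add: w_def)
    have "continuous_on UNIV (\<lambda>t. apply_bcontfun b t - a t \<bullet> y)"
      using a by (intro continuous_intros) auto
    then obtain \<mu> where \<mu>: "\<mu> > 0" "\<And>t. \<mu> \<le> apply_bcontfun b t - a t \<bullet> y"
      using continuous_on_compact_space_pos_bound[OF T, of "\<lambda>t. apply_bcontfun b t - a t \<bullet> y"] y
      by (metis (no_types, lifting) UNIV_I diff_gt_0_iff_gt)
    \<comment> \<open>Halving \<mu> produces the strict inequality that \<open>G_set\<close>
      demands.\<close>
    have "\<mu> / (2 * N w) < a t \<bullet> ((1 / N w) *\<^sub>R w)" if "t \<in> active_indices a b x" for t
    proof -
      have "\<mu> \<le> a t \<bullet> w"
        using that \<mu>(2)[of t] by (simp add: active_indices_def w_def inner_diff_right)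
      then show ?thesis using \<mu>(1) w(2) by (simp add: field_simps)
    qed
    then have "(\<mu> / (2 * N w), (1 / N w) *\<^sub>R w) \<in> G_set N a b x"
      using w \<mu>(1) by (simp add: G_set_def)
    then show ?thesis by blast
  qed
qed

text \<open>Where the product of \<open>a t\<close> with z exceeds \<alpha>, the shift gains at
  least \<delta> of slack, which pays for the change of b. The remaining indices form a compact set
  without active indices, where the slack is uniformly positive and absorbs small losses.\<close>

lemma shifted_point_feasible:
  fixes a :: "'t::topological_space \<Rightarrow> real ^ 'p"
  assumes T: "compact (UNIV :: 't set)" and a: "continuous_on UNIV a"
    and x: "x \<in> feasible_set a b" and G: "(\<alpha>, z) \<in> G_set N a b x"
  obtains \<eta> where "\<eta> > 0"
    "\<And>\<delta> b'. norm (b' - b) \<le> \<delta> \<Longrightarrow> \<delta> < \<eta> \<Longrightarrow> x - (\<delta> / \<alpha>) *\<^sub>R z \<in> feasible_set a b'"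
proof -
  have \<alpha>: "\<alpha> > 0" and act: "\<And>t. a t \<bullet> x = apply_bcontfun b t \<Longrightarrow> a t \<bullet> z > \<alpha>"
    using G by (auto simp: G_set_def active_indices_def)
  define K where "K = {t. a t \<bullet> z \<le> \<alpha>}"
  have "closed K"
    unfolding K_def using a by (intro closed_Collect_le continuous_intros)
  then have K: "compact K"
    using compact_Int_closed[OF T] by simp
  have pos: "0 < apply_bcontfun b t - a t \<bullet> x" if "t \<in> K" for t
  proof -
    have "a t \<bullet> x \<le> apply_bcontfun b t" using x by (simp add: feasible_set_def)
    moreover have "a t \<bullet> x \<noteq> apply_bcontfun b t" using act[of t] that by (auto simp: K_def)
    ultimately show ?thesis by simp
  qed
  have "continuous_on K (\<lambda>t. apply_bcontfun b t - a t \<bullet> x)"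
    by (intro continuous_intros continuous_on_subset[OF a]) auto
  then obtain \<mu> where \<mu>: "\<mu> > 0" "\<And>t. t \<in> K \<Longrightarrow> \<mu> \<le> apply_bcontfun b t - a t \<bullet> x"
    using continuous_on_compact_space_pos_bound[OF K _ pos, of "\<lambda>t. t"] by blast
  have "compact (range (\<lambda>t. a t \<bullet> z))"
    using T a by (intro compact_continuous_image continuous_intros)
  then obtain B where B: "B > 0" "\<And>t. \<bar>a t \<bullet> z\<bar> \<le> B"
    using compact_imp_bounded[of "range (\<lambda>t. a t \<bullet> z)"] by (auto simp: bounded_pos)
  show thesis
  proof
    \<comment> \<open>On K the shift costs at most \<delta> B / \<alpha> and the change of b at most
      \<delta>; below this threshold their sum is less than \<mu>.\<close>
    show "0 < \<mu> / (1 + B / \<alpha>)"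
      using \<mu>(1) B(1) \<alpha> by (intro divide_pos_pos add_pos_pos) auto
    fix \<delta> b' assume b': "norm (b' - b) \<le> \<delta>" and \<delta>: "\<delta> < \<mu> / (1 + B / \<alpha>)"
    have \<delta>0: "0 \<le> \<delta>" using b' norm_ge_zero order_trans by blast
    have "a t \<bullet> (x - (\<delta> / \<alpha>) *\<^sub>R z) \<le> apply_bcontfun b' t" for t
    proof -
      have "\<bar>apply_bcontfun b' t - apply_bcontfun b t\<bar> \<le> \<delta>"
        using norm_bounded[of "b' - b" t] b' by simp
      moreover have "a t \<bullet> (x - (\<delta> / \<alpha>) *\<^sub>R z) \<le> apply_bcontfun b t - \<delta>"
      proof (cases "t \<in> K")
        case True
        have "0 < 1 + B / \<alpha>" using B(1) \<alpha> by (intro add_pos_pos) auto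
        then have "\<delta> + (\<delta> / \<alpha>) * B < \<mu>"
          using \<delta> by (simp add: pos_less_divide_eq algebra_simps)
        moreover have "(\<delta> / \<alpha>) * (- (a t \<bullet> z)) \<le> (\<delta> / \<alpha>) * B"
          using B(2)[of t] \<delta>0 \<alpha> by (intro mult_left_mono) auto
        ultimately show ?thesis
          using \<mu>(2)[OF True] by (simp add: inner_diff_right)
      next
        case False
        then have "(\<delta> / \<alpha>) * \<alpha> \<le> (\<delta> / \<alpha>) * (a t \<bullet> z)"
          using \<delta>0 \<alpha> by (intro mult_left_mono) (auto simp: K_def)
        moreover have "a t \<bullet> x \<le> apply_bcontfun b t"
          using x by (simp add: feasible_set_def)
        ultimately show ?thesis
          using \<alpha> by (simp add: inner_diff_right)
      qed
      ultimately show ?thesis by linarith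
    qed
    then show "x - (\<delta> / \<alpha>) *\<^sub>R z \<in> feasible_set a b'"
      by (simp add: feasible_set_def)
  qed
qed

section \<open>Transfer of calmness constants from level sets to optimal sets\<close>

lemma optimal_set_eq_level_set:
  assumes "x \<in> optimal_set a (c, b)"
  shows "optimal_set a (c, b) = level_set a c (c \<bullet> x, b)"
  using assms by (auto simp: feasible_set_def intro: order_trans)

text \<open>The strict gap between r and the quotient of the chosen pair absorbs all error terms
  that vanish near the base point.\<close>

lemma calm_const_optimal_of_level:
  fixes a :: "'t::topological_space \<Rightarrow> real ^ 'p"
  assumes T: "compact (UNIV :: 't set)" and a: "continuous_on UNIV a" and N: "is_norm N"
    and x: "x \<in> optimal_set a (c, b)" and G: "(\<alpha>, z) \<in> G_set N a b x"
    and r: "1 \<le> r" "- (c \<bullet> z) / \<alpha> < r"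
    and calm: "calm_const level_param_norm N (level_set a c) (c \<bullet> x, b) x \<kappa>"
  shows "calm_const (param_norm N) N (optimal_set a) (c, b) x (\<kappa> * r)"
proof -
  have \<alpha>: "\<alpha> > 0" and Nz: "N z = 1"
    using G by (auto simp: G_set_def)
  have xf: "x \<in> feasible_set a b" using x by simp
  obtain \<eta> where \<eta>: "\<eta> > 0"
    "\<And>\<delta> b'. norm (b' - b) \<le> \<delta> \<Longrightarrow> \<delta> < \<eta> \<Longrightarrow> x - (\<delta> / \<alpha>) *\<^sub>R z \<in> feasible_set a b'"
    using shifted_point_feasible[OF T a xf G] by blast
  obtain \<epsilon> where \<kappa>: "0 \<le> \<kappa>" and \<epsilon>: "\<epsilon> > 0"
    "\<And>y u. level_param_norm (y - (c \<bullet> x, b)) < \<epsilon> \<Longrightarrow> N (u - x) < \<epsilon> \<Longrightarrow> u \<in> level_set a c y \<Longrightarrow>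
       dist_to_set (norm_dist N) u (level_set a c (c \<bullet> x, b))
         \<le> \<kappa> * level_param_norm (y - (c \<bullet> x, b))"
    using calm unfolding calm_const_def by blast
  define g where "g = r - - (c \<bullet> z) / \<alpha>"
  have g: "g > 0" using r by (simp add: g_def)
  \<comment> \<open>In order: u is close enough for level calmness, the perturbed level parameter
    stays within \<epsilon>, the shifted point is feasible, and the error terms
    \<open>N (u - x)\<close> and \<delta> / \<alpha> each take at most half of the gap.\<close>
  define \<rho> where "\<rho> = Min {\<epsilon>, \<epsilon> / r, \<eta>, g / 2, \<alpha> * g / 2}"
  have \<rho>_pos: "\<rho> > 0"
    using \<epsilon>(1) \<eta>(1) g \<alpha> r(1) by (simp add: \<rho>_def)
  have \<rho>_le: "\<rho> \<le> \<epsilon>" "\<rho> \<le> \<epsilon> / r" "\<rho> \<le> \<eta>" "\<rho> \<le> g / 2" "\<rho> \<le> \<alpha> * g / 2"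
    unfolding \<rho>_def by (rule Min_le; simp)+
  note \<rho> = \<rho>_pos \<rho>_le
  have bound: "dist_to_set (norm_dist N) u (optimal_set a (c, b))
      \<le> \<kappa> * r * param_norm N (y - (c, b))"
    if y: "param_norm N (y - (c, b)) < \<rho>" and u: "N (u - x) < \<rho>" and opt: "u \<in> optimal_set a y"
    for y u
  proof -
    obtain c' b' where y_eq: "y = (c', b')" by (cases y)
    define \<delta> where "\<delta> = param_norm N (y - (c, b))"
    have \<delta>c: "dual_norm N (c' - c) \<le> \<delta>" and \<delta>b: "norm (b' - b) \<le> \<delta>"
      by (simp_all add: \<delta>_def y_eq)
    have \<delta>0: "0 \<le> \<delta>" using \<delta>b norm_ge_zero order_trans by blast
    have \<delta>: "\<delta> < \<rho>" using y by (simp add: \<delta>_def)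
    have pert: "(c' - c) \<bullet> v \<le> \<delta> * N v" for v
      using inner_le_dual_norm[OF N, of "c' - c" v]
        mult_right_mono[OF \<delta>c is_norm_nonneg[OF N, of v]] by linarith
    have "x - (\<delta> / \<alpha>) *\<^sub>R z \<in> feasible_set a b'"
      using \<eta>(2)[OF \<delta>b] \<delta> \<rho>(4) by simp
    \<comment> \<open>The shifted point competes with the solution u of the perturbed
      problem.\<close>
    then have "c' \<bullet> u \<le> c' \<bullet> (x - (\<delta> / \<alpha>) *\<^sub>R z)"
      using opt by (simp add: y_eq)
    then have "c' \<bullet> (u - x) \<le> (\<delta> / \<alpha>) * (- (c' \<bullet> z))"
      by (simp add: inner_diff_right)
    \<comment> \<open>Returning from c' to c costs at most \<delta> on the unit vector z.\<close>
    also have "\<dots> \<le> (\<delta> / \<alpha>) * (- (c \<bullet> z) + \<delta>)"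
      using pert[of "- z"] Nz \<delta>0 \<alpha>
      by (intro mult_left_mono) (auto simp: is_norm_minus[OF N] inner_diff_left)
    finally have 1: "c' \<bullet> (u - x) \<le> \<delta> * (- (c \<bullet> z) / \<alpha> + \<delta> / \<alpha>)"
      by (simp add: distrib_left diff_divide_distrib right_diff_distrib)
    \<comment> \<open>On u - x the same replacement costs \<delta> times a quantity that is small
      near x.\<close>
    have "(c - c') \<bullet> (u - x) \<le> \<delta> * N (u - x)"
      using pert[of "x - u"] is_norm_minus[OF N, of "u - x"]
      by (simp add: inner_diff_left inner_diff_right)
    moreover have "c \<bullet> (u - x) = c' \<bullet> (u - x) + (c - c') \<bullet> (u - x)"
      by (simp add: inner_diff_left)
    ultimately have "c \<bullet> (u - x) \<le> \<delta> * (- (c \<bullet> z) / \<alpha> + \<delta> / \<alpha> + N (u - x))"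
      using 1 by (simp add: distrib_left)
    also have "\<dots> \<le> \<delta> * r"
    proof (intro mult_left_mono \<delta>0)
      have "\<delta> / \<alpha> \<le> g / 2" using \<delta> \<rho>(6) \<alpha> by (simp add: pos_divide_le_eq mult.commute)
      moreover have "- (c \<bullet> z) / \<alpha> + g = r" by (simp add: g_def)
      ultimately show "- (c \<bullet> z) / \<alpha> + \<delta> / \<alpha> + N (u - x) \<le> r"
        using u \<rho>(5) by linarith
    qed
    finally have 2: "c \<bullet> u - c \<bullet> x \<le> \<delta> * r" by (simp add: inner_diff_right)
    \<comment> \<open>Only an upper bound for the change of the objective is known. The maximum
      prevents the level from dropping below its base value, so its absolute change is at most
      \<delta> r.\<close>
    define y' where "y' = (max (c \<bullet> x) (c \<bullet> u), b')"
    have \<delta>r: "0 \<le> \<delta> * r" "\<delta> \<le> \<delta> * r" using \<delta>0 r(1) mult_left_mono[of 1 r \<delta>] by auto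
    then have y': "level_param_norm (y' - (c \<bullet> x, b)) \<le> \<delta> * r"
      using 2 \<delta>b by (auto simp: y'_def)
    also have "\<delta> * r < \<epsilon>"
    proof -
      have "\<delta> < \<epsilon> / r" using \<delta> \<rho>(3) by simp
      then show ?thesis using r(1) by (simp add: pos_less_divide_eq)
    qed
    finally have small: "level_param_norm (y' - (c \<bullet> x, b)) < \<epsilon>" .
    have mem: "u \<in> level_set a c y'"
      using opt by (simp add: y'_def y_eq feasible_set_def)
    have "N (u - x) < \<epsilon>" using u \<rho>(2) by simp
    note \<epsilon>(2)[OF small this mem]
    also have "\<kappa> * level_param_norm (y' - (c \<bullet> x, b)) \<le> \<kappa> * (\<delta> * r)"
      by (intro mult_left_mono y' \<kappa>)
    finally show ?thesis
      using optimal_set_eq_level_set[OF x] by (simp add: \<delta>_def mult_ac)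
  qed
  have "0 \<le> \<kappa> * r" using \<kappa> r(1) by simp
  then show ?thesis
    unfolding calm_const_def using \<rho>(1) bound by blast
qed

theorem theorem11:
  fixes a :: "'t::t2_space \<Rightarrow> real ^ 'p"
    and N :: "real ^ 'p \<Rightarrow> real"
    and c x :: "real ^ 'p"
    and b :: "'t \<Rightarrow>\<^sub>C real"
  assumes "compact (UNIV :: 't set)"
    and "continuous_on UNIV a"
    and "is_norm N"
    and "slater a b"
    and "x \<in> optimal_set a (c, b)"
  shows "clm_optimal N a (c, b) x
           \<le> max (lambda_bar N a c b x) 1 * clm_level N a c (c \<bullet> x, b) x"
proof -
  let ?C = "calm_const level_param_norm N (level_set a c) (c \<bullet> x, b) x"
  have clm_level: "clm_level N a c (c \<bullet> x, b) x = Inf {ereal \<kappa> |\<kappa>. ?C \<kappa>}"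
    unfolding clm_level_def
    by (rule calmness_modulus_eq_Inf_calm_const[OF is_norm_level_param_norm assms(3)])
  obtain \<alpha>0 z0 where "(\<alpha>0, z0) \<in> G_set N a b x"
    using G_set_nonempty[OF assms(1-4), of x] by auto
  then have "lambda_bar N a c b x \<le> ereal (- (c \<bullet> z0) / \<alpha>0)"
    unfolding lambda_bar_def by (rule INF_lower2) simp
  \<comment> \<open>Bounded above through one member of \<open>G_set\<close> and below by 1, the
    factor is a real number m.\<close>
  then have "max (lambda_bar N a c b x) 1 \<noteq> \<infinity>" "1 \<le> max (lambda_bar N a c b x) 1"
    by (auto simp: max_def)
  then obtain m where m: "max (lambda_bar N a c b x) 1 = ereal m" "1 \<le> m"
    by (cases "max (lambda_bar N a c b x) 1") auto
  \<comment> \<open>The infimum in \<open>lambda_bar\<close> need not be attained. Each r > m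
    exceeds the quotient of some pair in \<open>G_set\<close>, and r then decreases to m.\<close>
  have le: "clm_optimal N a (c, b) x \<le> ereal (\<kappa> * m)" if \<kappa>: "?C \<kappa>" for \<kappa>
  proof (rule tendsto_lowerbound)
    show "((\<lambda>r. ereal (\<kappa> * r)) \<longlongrightarrow> ereal (\<kappa> * m)) (at_right m)"
      by (intro tendsto_intros)
    have "clm_optimal N a (c, b) x \<le> ereal (\<kappa> * r)" if "m < r" for r
    proof -
      have "lambda_bar N a c b x \<le> ereal m"
        using m(1) max.cobounded1 by metis
      also have "\<dots> < ereal r" using that by simp
      finally obtain \<alpha> z where "(\<alpha>, z) \<in> G_set N a b x" "- (c \<bullet> z) / \<alpha> < r"
        unfolding lambda_bar_def INF_less_iff by auto
      then have "calm_const (param_norm N) N (optimal_set a) (c, b) x (\<kappa> * r)"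
        using calm_const_optimal_of_level[OF assms(1-3,5)] \<kappa> m(2) that by simp
      then show ?thesis
        unfolding clm_optimal_def
          calmness_modulus_eq_Inf_calm_const[OF is_norm_param_norm[OF assms(3)] assms(3)]
        by (intro Inf_lower) blast
    qed
    then show "\<forall>\<^sub>F r in at_right m. clm_optimal N a (c, b) x \<le> ereal (\<kappa> * r)"
      by (auto simp: eventually_at_right_less eventually_at_filter)
  qed simp
  have "clm_optimal N a (c, b) x \<le> (INF k\<in>{ereal \<kappa> |\<kappa>. ?C \<kappa>}. ereal m * k)"
    using le by (intro INF_greatest) (auto simp: mult.commute)
  \<comment> \<open>A positive real factor commutes with the extended infimum, also when there is no
    calmness constant and both sides are \<infinity>.\<close>
  also have "\<dots> = ereal m * Inf {ereal \<kappa> |\<kappa>. ?C \<kappa>}"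
    using m(2) ereal_Inf_cmult[of m "\<lambda>k. \<exists>\<kappa>. k = ereal \<kappa> \<and> ?C \<kappa>"]
    by (simp add: image_Collect)
  finally show ?thesis
    unfolding m(1) clm_level .
qed

end
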